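(* Let $H$ be a connected $P_5$-free graph whose vertex set is partitioned into three sets $P$, $Q$ and $\{v\}$, where $v$ is adjacent to every vertex of $Q$ and to no vertex of $P$. Then there is at most one connected component of the induced subgraph $H[P]$ that contains two vertices $a$ and $b$ for which there exist connected components $Y_1\neq Y_2$ of $H[Q]$ such that $a$ is adjacent to $Y_1$ but not adjacent to $Y_2$, while $b$ is adjacent to $Y_2$ but not adjacent to $Y_1$.
   Context: $P_5$ is the path on five vertices; a graph is $P_5$-free if it has no induced subgraph isomorphic to $P_5$. $H[S]$ denotes the subgraph of $H$ induced by $S$. A vertex is adjacent to a component if it is adjacent to at least one vertex of that component. *)

theory Defs
  imports
    "Graph_Theory.Digraph_Component"
    "Graph_Theory.Digraph_Isomorphism"
begin

text \<open>
  A simple undirected graph is a \<^typ>\<open>'a pair_pre_digraph\<close> satisfying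
  \<^locale>\<open>pair_bidirected_digraph\<close>: every edge is represented by its two orientations, there are
  no loops, and the vertex set need not be finite. The coercion \<^const>\<open>with_proj\<close> turns it into
  the general digraph record on which subgraphs and connectedness are defined.
\<close>

definition path_graph :: "nat \<Rightarrow> nat pair_pre_digraph" where
  "path_graph n =
    \<lparr> pverts = {..<n}, parcs = {(i, j). i < n \<and> j < n \<and> (j = Suc i \<or> i = Suc j)} \<rparr>"

definition induced_free :: "('a, 'b) pre_digraph \<Rightarrow> ('c, 'd) pre_digraph \<Rightarrow> bool" where
  "induced_free G F \<longleftrightarrow> \<not> (\<exists>K. induced_subgraph K G \<and> digraph_iso K F)"

text \<open>
  Maximality is with respect to the subgraph relation; \<^const>\<open>connected\<close> ignores the orientation
  of arcs and excludes the null graph, so components are nonempty.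
\<close>
definition connected_components :: "('a, 'b) pre_digraph \<Rightarrow> ('a, 'b) pre_digraph set" where
  "connected_components G = {C. pre_digraph.max_subgraph G connected C}"

definition adjacent_to_component ::
    "('a, 'b) pre_digraph \<Rightarrow> 'a \<Rightarrow> ('a, 'b) pre_digraph \<Rightarrow> bool" where
  "adjacent_to_component G u C \<longleftrightarrow> (\<exists>w \<in> verts C. u \<rightarrow>\<^bsub>G\<^esub> w)"

end

theory Submission
  imports Defs
begin

text \<open>
  For a vertex \<open>a\<close> of \<open>P\<close> let \<open>A\<close> be the set of components of \<open>H[Q]\<close> adjacent to \<open>a\<close>. If two
  vertices of \<open>P\<close> have incomparable such sets, witnessed by \<open>y\<^sub>1\<close> and \<open>y\<^sub>2\<close>, they are adjacent, since
  otherwise \<open>a y\<^sub>1 v y\<^sub>2 b\<close> is an induced path. Suppose two components of \<open>H[P]\<close> contain incomparable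
  pairs \<open>a, b\<close> and \<open>a', b'\<close>. Vertices in different components have comparable sets, which forces
  \<open>A \<union> B \<subseteq> A' \<inter> B'\<close> up to swapping the pairs. Choose a component \<open>Y\<close> in \<open>A - B\<close> and a neighbour \<open>z\<close>
  of \<open>a'\<close> in a component belonging to \<open>A' - B'\<close>. Following the distance in \<open>Y\<close> from the neighbours of
  \<open>a'\<close> shows that \<open>a\<close> and \<open>a'\<close> have a common neighbour \<open>y\<close> in \<open>Y\<close>, as otherwise some induced path
  begins with \<open>z a'\<close> and continues for three more vertices. Then \<open>z a' y a b\<close> is an induced path.
\<close>

section \<open>Connectedness by cuts, and components\<close>

text \<open>Reachability in the symmetric closure never leaves a set that no arc crosses, and the
  vertices reachable from a given one form such a set. This cut form suits unions of subgraphs and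
  neighbourhoods better than explicit walks.\<close>

lemma connected_iff_no_closed_subset:
  assumes "wf_digraph G"
  shows "connected G \<longleftrightarrow> verts G \<noteq> {} \<and>
    (\<forall>S \<subseteq> verts G. S \<noteq> {} \<longrightarrow> (\<forall>e \<in> arcs G. tail G e \<in> S \<longleftrightarrow> head G e \<in> S) \<longrightarrow> S = verts G)"
proof -
  interpret pair_wf_digraph "mk_symmetric G"
    using assms by (rule wf_digraph.wellformed_mk_symmetric)
  have sym_arcs: "\<exists>e \<in> arcs G. {x, y} = {tail G e, head G e}" if "(x, y) \<in> parcs (mk_symmetric G)" for x y
    using that by (auto simp: parcs_mk_symmetric)
  show ?thesis
  proof (intro iffI conjI allI impI)
    assume conn: "connected G"
    then show "verts G \<noteq> {}"
      by (auto simp: connected_def strongly_connected_def)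
    fix S assume S: "S \<subseteq> verts G" "S \<noteq> {}" and closed: "\<forall>e \<in> arcs G. tail G e \<in> S \<longleftrightarrow> head G e \<in> S"
    from S obtain u where u: "u \<in> S" by blast
    have "w \<in> S" if "w \<in> verts G" for w
    proof -
      have "u \<rightarrow>\<^sup>*\<^bsub>mk_symmetric G\<^esub> w"
        using conn u S that by (auto simp: connected_def strongly_connected_def)
      then show ?thesis
      proof (induct rule: reachable_induct)
        case base
        then show ?case using u by simp
      next
        case (step x y)
        then have "(x, y) \<in> parcs (mk_symmetric G)" by simp
        from sym_arcs[OF this] closed step(3) show ?case
          by (metis doubleton_eq_iff)
      qed
    qed
    with S show "S = verts G" by blast
  next
    assume cut: "verts G \<noteq> {} \<and>
      (\<forall>S \<subseteq> verts G. S \<noteq> {} \<longrightarrow> (\<forall>e \<in> arcs G. tail G e \<in> S \<longleftrightarrow> head G e \<in> S) \<longrightarrow> S = verts G)"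
    have "u \<rightarrow>\<^sup>*\<^bsub>mk_symmetric G\<^esub> w" if u: "u \<in> verts G" and w: "w \<in> verts G" for u w
    proof -
      define S where "S = {x. u \<rightarrow>\<^sup>*\<^bsub>mk_symmetric G\<^esub> x}"
      have "S \<subseteq> verts G"
        using reachable_in_verts(2) by (fastforce simp: S_def)
      moreover have "u \<in> S"
        using u by (simp add: S_def)
      moreover have "tail G e \<in> S \<longleftrightarrow> head G e \<in> S" if "e \<in> arcs G" for e
      proof -
        have "(tail G e, head G e) \<in> parcs (mk_symmetric G)" "(head G e, tail G e) \<in> parcs (mk_symmetric G)"
          using that by (auto simp: parcs_mk_symmetric)
        then show ?thesis
          unfolding S_def by (auto intro: reachable_adj_trans)
      qed
      ultimately have "S = verts G"
        using cut by blast
      with w show ?thesis by (auto simp: S_def)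
    qed
    with cut show "connected G"
      by (auto simp: connected_def strongly_connected_def)
  qed
qed

lemma connected_component_subgraph:
  assumes "C \<in> connected_components G"
  shows "subgraph C G" "connected C"
  using assms by (auto simp: connected_components_def pre_digraph.max_subgraph_def)

lemma verts_connected_component_induce:
  assumes "C \<in> connected_components (G \<restriction> S)"
  shows "verts C \<subseteq> S"
  using subgraph_imp_subverts[OF connected_component_subgraph(1)[OF assms]] by simp

text \<open>The arc makes the subgraph induced on the union of both vertex sets connected. Since it
  contains \<open>C\<close> and \<open>D\<close>, maximality makes each of them equal to it.\<close>

lemma arc_between_components_imp_eq:
  assumes C: "C \<in> connected_components G" and D: "D \<in> connected_components G"
    and e: "e \<in> arcs G" "tail G e \<in> verts C" "head G e \<in> verts D"
  shows "C = D"
proof -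
  note subC = connected_component_subgraph[OF C] and subD = connected_component_subgraph[OF D]
  interpret wf_digraph G using subC by auto
  let ?K = "G \<restriction> (verts C \<union> verts D)"
  have wfK: "wf_digraph ?K" ..
  have vK: "verts ?K = verts C \<union> verts D"
    by simp
  have sub: "subgraph B ?K" if B: "B = C \<or> B = D" for B
  proof -
    interpret B: wf_digraph B using B subC subD by auto
    have comp: "tail G = tail B" "head G = head B" and "arcs B \<subseteq> arcs G"
      using B subC subD by (auto simp: compatible_def subgraph_def)
    moreover have BK: "verts B \<subseteq> verts ?K"
      using B by auto
    ultimately have "arcs B \<subseteq> arcs ?K"
      using B.wellformed by (auto simp: subset_iff)
    with BK comp show ?thesis
      by (intro subgraphI wfK B.wf_digraph_axioms) (simp_all add: compatible_def)
  qed
  \<comment> \<open>The trace on \<open>B\<close> of a set crossed by no arc of \<open>?K\<close> is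
    crossed by no arc of \<open>B\<close>, so connectedness of \<open>B\<close> makes the trace all
    of \<open>B\<close>.\<close>
  have whole: "verts B \<subseteq> S"
    if B: "B = C \<or> B = D" and S: "S \<inter> verts B \<noteq> {}"
      and closed: "\<forall>e \<in> arcs ?K. tail ?K e \<in> S \<longleftrightarrow> head ?K e \<in> S" for B S
  proof -
    interpret B: wf_digraph B using B subC subD by auto
    have "connected B" using B subC subD by auto
    moreover have "tail B e \<in> S \<inter> verts B \<longleftrightarrow> head B e \<in> S \<inter> verts B" if "e \<in> arcs B" for e
    proof -
      have "e \<in> arcs ?K" "tail ?K = tail B" "head ?K = head B"
        using sub[OF B] that by (auto simp: compatible_def subgraph_def)
      then show ?thesis
        using closed that by auto
    qed
    ultimately have "S \<inter> verts B = verts B"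
      using S connected_iff_no_closed_subset[OF B.wf_digraph_axioms] by (meson Int_lower2)
    then show ?thesis by blast
  qed
  have eK: "e \<in> arcs ?K" "tail ?K e = tail G e" "head ?K e = head G e"
    using e by auto
  have "S = verts ?K" if "S \<subseteq> verts ?K" "S \<noteq> {}"
    and closed: "\<forall>e \<in> arcs ?K. tail ?K e \<in> S \<longleftrightarrow> head ?K e \<in> S" for S
  proof -
    have "S \<inter> verts C \<noteq> {} \<or> S \<inter> verts D \<noteq> {}"
      using that(1,2) unfolding vK by blast
    \<comment> \<open>Once \<open>S\<close> swallows one of the two components it contains an end of
      \<open>e\<close>, hence the other end too, and so meets the other component.\<close>
    then have "S \<inter> verts C \<noteq> {}" "S \<inter> verts D \<noteq> {}"
      using whole[of C S] whole[of D S] closed e eK by (metis disjoint_iff subset_iff)+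
    then have "verts C \<subseteq> S" "verts D \<subseteq> S"
      using whole closed by blast+
    with that(1) show ?thesis unfolding vK by blast
  qed
  moreover have "verts ?K \<noteq> {}"
    using e by auto
  ultimately have "connected ?K"
    using connected_iff_no_closed_subset[OF wfK] by blast
  moreover have "subgraph ?K G"
    using subC subD by (intro subgraph_induce_subgraphI) (simp add: subgraph_imp_subverts)
  ultimately have "?K = C" "?K = D"
    using C D sub by (auto simp: connected_components_def pre_digraph.max_subgraph_def)
  then show ?thesis by simp
qed

section \<open>Induced five-vertex paths in a simple graph\<close>

context pair_bidirected_digraph
begin

lemma parcs_commute: "(x, y) \<in> parcs G \<longleftrightarrow> (y, x) \<in> parcs G"
  using arcs_symmetric by blast

text \<open>The ten conditions already force distinctness: any two of the vertices are adjacent, or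
  a third one is adjacent to exactly one of them.\<close>

lemma induced_P5_imp_not_free:
  assumes adj: "(x0, x1) \<in> parcs G" "(x1, x2) \<in> parcs G" "(x2, x3) \<in> parcs G" "(x3, x4) \<in> parcs G"
    and nonadj: "(x0, x2) \<notin> parcs G" "(x0, x3) \<notin> parcs G" "(x0, x4) \<notin> parcs G"
      "(x1, x3) \<notin> parcs G" "(x1, x4) \<notin> parcs G" "(x2, x4) \<notin> parcs G"
  shows "\<not> induced_free (with_proj G) (with_proj (path_graph 5))"
proof -
  let ?K = "with_proj G \<restriction> {x0, x1, x2, x3, x4}"
  have irr: "(x, x) \<notin> parcs G" for x
    using pair_no_loops by force
  have adj': "(x1, x0) \<in> parcs G" "(x2, x1) \<in> parcs G" "(x3, x2) \<in> parcs G" "(x4, x3) \<in> parcs G"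
    using adj by (simp_all add: arcs_symmetric)
  have nonadj': "(x2, x0) \<notin> parcs G" "(x3, x0) \<notin> parcs G" "(x4, x0) \<notin> parcs G"
      "(x3, x1) \<notin> parcs G" "(x4, x1) \<notin> parcs G" "(x4, x2) \<notin> parcs G"
    using nonadj by (simp_all add: parcs_commute)
  have dist: "x0 \<noteq> x1" "x0 \<noteq> x2" "x0 \<noteq> x3" "x0 \<noteq> x4" "x1 \<noteq> x2" "x1 \<noteq> x3" "x1 \<noteq> x4"
    "x2 \<noteq> x3" "x2 \<noteq> x4" "x3 \<noteq> x4"
    using adj nonadj adj' nonadj' irr by auto
  note dist' = dist dist[symmetric]
  have verts: "{x0, x1, x2, x3, x4} \<subseteq> pverts G"
    using adj wellformed' by blast
  have arcs: "arcs ?K = {(x0, x1), (x1, x0), (x1, x2), (x2, x1), (x2, x3), (x3, x2), (x3, x4), (x4, x3)}"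
    (is "_ = ?E")
  proof
    show "?E \<subseteq> arcs ?K"
      by (simp add: adj adj')
    have "(x, y) \<in> ?E" if "(x, y) \<in> parcs G" "x \<in> {x0, x1, x2, x3, x4}" "y \<in> {x0, x1, x2, x3, x4}"
      for x y
      using that(2,3,1) by (elim insertE emptyE; simp add: nonadj nonadj' irr)
    then show "arcs ?K \<subseteq> ?E"
      by (simp add: subset_iff del: insert_iff)
  qed
  \<comment> \<open>\<open>f\<close> numbers the vertices along the path; the final
    \<open>else\<close> stands for \<open>x4\<close>. Arcs are pairs, so \<open>map_prod f f\<close>
    is the matching arc map.\<close>
  define f where "f x = (if x = x0 then 0 else if x = x1 then 1 else if x = x2 then 2
    else if x = x3 then 3 else 4 :: nat)" for x
  have f: "f x0 = 0" "f x1 = 1" "f x2 = 2" "f x3 = 3" "f x4 = 4"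
    using dist' by (auto simp: f_def)
  define h where "h = \<lparr>iso_verts = f, iso_arcs = map_prod f f, iso_head = snd, iso_tail = fst\<rparr>"
  have "wf_digraph ?K" ..
  moreover have inj: "inj_on f {x0, x1, x2, x3, x4}"
    using f by (auto simp: inj_on_def)
  moreover have "inj_on (map_prod f f) (arcs ?K)"
    by (rule inj_on_subset[OF map_prod_inj_on[OF inj inj]]) (unfold arcs, simp)
  ultimately have iso: "pre_digraph.digraph_isomorphism ?K h"
    by (simp add: pre_digraph.digraph_isomorphism_def h_def)
  have less5: "i < 5 \<longleftrightarrow> i \<in> {0, 1, 2, 3, 4}" for i :: nat
    by auto
  have "parcs (path_graph 5) = {(0, 1), (1, 0), (1, 2), (2, 1), (2, 3), (3, 2), (3, 4), (4, 3)}"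
    by (auto simp: path_graph_def less5)
  moreover have "pverts (path_graph 5) = {0, 1, 2, 3, 4}"
    by (auto simp: path_graph_def less5)
  ultimately have "with_proj (path_graph 5) = app_iso h ?K"
    by (intro pre_digraph.equality)
      (simp_all add: arcs f h_def del: induce_subgraph_arcs)
  with iso have "digraph_iso ?K (with_proj (path_graph 5))"
    by (auto simp: digraph_iso_def)
  moreover have "induced_subgraph ?K (with_proj G)"
    using verts by (intro induced_induce) simp
  ultimately show ?thesis
    by (auto simp: induced_free_def)
qed

text \<open>The vertex \<open>z\<close> hangs on \<open>a'\<close> and sees neither \<open>a\<close>
  nor \<open>Y\<close>, so any induced path that starts at \<open>a'\<close> and takes three more
  steps through \<open>Y\<close>, possibly ending in \<open>a\<close>, would extend to a forbidden
  one.\<close>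

lemma common_neighbour_in_connected_subgraph:
  assumes free: "induced_free (with_proj G) (with_proj (path_graph 5))"
    and Y: "subgraph Y (with_proj G)" "connected Y"
    and a: "adjacent_to_component (with_proj G) a Y"
    and a': "adjacent_to_component (with_proj G) a' Y" "(a', a) \<notin> parcs G"
    and z: "(z, a') \<in> parcs G" "(z, a) \<notin> parcs G" "\<not> adjacent_to_component (with_proj G) z Y"
  shows "\<exists>y \<in> verts Y. (a, y) \<in> parcs G \<and> (a', y) \<in> parcs G"
proof (rule ccontr)
  assume no_common: "\<not> ?thesis"
  interpret Y: wf_digraph Y using Y(1) by auto
  define S where "S = {y \<in> verts Y. (a', y) \<in> parcs G}"
  \<comment> \<open>The vertices of \<open>Y\<close> at distance at most one from \<open>S\<close>,
    the neighbours of \<open>a'\<close>.\<close>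
  define N where "N = {y \<in> verts Y. y \<in> S \<or> (\<exists>s \<in> S. (s, y) \<in> parcs G)}"
  \<comment> \<open>The path is \<open>z a' s w u\<close>. Its end \<open>u\<close> may lie outside
    \<open>Y\<close>, so that \<open>u = a\<close> is covered as well.\<close>
  have no_path: False if "s \<in> S" "(s, w) \<in> parcs G" "w \<in> verts Y" "w \<notin> S" "(w, u) \<in> parcs G"
    "(z, u) \<notin> parcs G" "(a', u) \<notin> parcs G" "(s, u) \<notin> parcs G" for s w u
    using induced_P5_imp_not_free[of z a' s w u] that free z
    by (auto simp: S_def adjacent_to_component_def)
  show False
  proof (cases "N = verts Y")
    case True
    obtain t where t: "t \<in> verts Y" "(a, t) \<in> parcs G"
      using a by (auto simp: adjacent_to_component_def)
    then have "t \<notin> S"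
      using no_common by (auto simp: S_def)
    with t True obtain s where s: "s \<in> S" "(s, t) \<in> parcs G"
      by (auto simp: N_def)
    then have "(s, a) \<notin> parcs G"
      using no_common by (auto simp: S_def parcs_commute)
    then show False
      using no_path[OF s t(1) \<open>t \<notin> S\<close>] t(2) z(2) a'(2) by (simp add: parcs_commute)
  next
    \<comment> \<open>Some edge \<open>w u\<close> of \<open>Y\<close> leaves \<open>N\<close>; then
      \<open>w\<close> is at distance one from \<open>S\<close> and \<open>u\<close> is not adjacent
      to \<open>S\<close>.\<close>
    case False
    have "N \<subseteq> verts Y" "N \<noteq> {}"
      using a' by (auto simp: N_def S_def adjacent_to_component_def)
    with False Y(2) obtain e where e: "e \<in> arcs Y" "\<not> (tail Y e \<in> N \<longleftrightarrow> head Y e \<in> N)"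
      using connected_iff_no_closed_subset[OF Y.wf_digraph_axioms] by blast
    have "tail Y = fst" "head Y = snd" "arcs Y \<subseteq> parcs G"
      using Y(1) by (auto simp: subgraph_def compatible_def)
    then have "(tail Y e, head Y e) \<in> parcs G"
      using e by auto
    with e obtain w u where wu: "(w, u) \<in> parcs G" "w \<in> N" "u \<notin> N" "u \<in> verts Y"
      using arcs_symmetric Y.wellformed[OF e(1)] by metis
    then have "w \<notin> S" "u \<notin> S"
      by (auto simp: N_def)
    with wu obtain s where "s \<in> S" "(s, w) \<in> parcs G" "w \<in> verts Y"
      by (auto simp: N_def)
    moreover have "(s, u) \<notin> parcs G" "(a', u) \<notin> parcs G" "(z, u) \<notin> parcs G"
      using wu \<open>u \<notin> S\<close> \<open>s \<in> S\<close> z(3) by (auto simp: N_def S_def adjacent_to_component_def)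
    ultimately show False
      using no_path wu \<open>w \<notin> S\<close> by blast
  qed
qed

lemma nonadjacent_in_distinct_components:
  assumes "C \<in> connected_components (with_proj G \<restriction> S)" "D \<in> connected_components (with_proj G \<restriction> S)"
    and "C \<noteq> D" "x \<in> verts C" "y \<in> verts D"
  shows "(x, y) \<notin> parcs G"
proof
  assume "(x, y) \<in> parcs G"
  moreover have "x \<in> S" "y \<in> S"
    using assms verts_connected_component_induce by blast+
  ultimately show False
    using arc_between_components_imp_eq[OF assms(1,2), of "(x, y)"] assms by simp
qed

lemma adjacent_if_incomparable:
  assumes free: "induced_free (with_proj G) (with_proj (path_graph 5))"
    and v: "\<forall>q \<in> Q. (v, q) \<in> parcs G" "(v, a) \<notin> parcs G" "(v, b) \<notin> parcs G"
    and Y: "Y1 \<in> connected_components (with_proj G \<restriction> Q)" "Y2 \<in> connected_components (with_proj G \<restriction> Q)"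
    and a: "adjacent_to_component (with_proj G) a Y1" "\<not> adjacent_to_component (with_proj G) a Y2"
    and b: "adjacent_to_component (with_proj G) b Y2" "\<not> adjacent_to_component (with_proj G) b Y1"
  shows "(a, b) \<in> parcs G"
proof (rule ccontr)
  assume ab: "(a, b) \<notin> parcs G"
  obtain y1 y2 where y: "y1 \<in> verts Y1" "(a, y1) \<in> parcs G" "y2 \<in> verts Y2" "(b, y2) \<in> parcs G"
    using a b by (auto simp: adjacent_to_component_def)
  have "Y1 \<noteq> Y2" using a by auto
  then have "(y1, y2) \<notin> parcs G"
    using nonadjacent_in_distinct_components Y y by blast
  moreover have "y1 \<in> Q" "y2 \<in> Q"
    using Y y verts_connected_component_induce by blast+
  moreover have "(a, y2) \<notin> parcs G" "(b, y1) \<notin> parcs G"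
    using a b y by (auto simp: adjacent_to_component_def)
  ultimately show False
    using induced_P5_imp_not_free[of a y1 v y2 b] free v y ab by (simp add: parcs_commute)
qed

text \<open>\<open>Z\<close> supplies a vertex \<open>z\<close> hanging on \<open>a'\<close>, so
  \<open>a\<close> and \<open>a'\<close> have a common neighbour \<open>y\<close> in
  \<open>Y\<close>. As \<open>b\<close> sees nothing of \<open>Y\<close>, an edge from
  \<open>a\<close> to \<open>b\<close> would complete the induced path
  \<open>z a' y a b\<close>.\<close>

lemma no_edge_below_private_component:
  assumes free: "induced_free (with_proj G) (with_proj (path_graph 5))"
    and Q: "Q \<subseteq> pverts G"
    and Y: "Y \<in> connected_components (with_proj G \<restriction> Q)" and Z: "Z \<in> connected_components (with_proj G \<restriction> Q)"
    and adjY: "adjacent_to_component (with_proj G) a Y" "\<not> adjacent_to_component (with_proj G) b Y"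
      "adjacent_to_component (with_proj G) a' Y"
    and adjZ: "adjacent_to_component (with_proj G) a' Z" "\<not> adjacent_to_component (with_proj G) a Z"
      "\<not> adjacent_to_component (with_proj G) b Z"
    and nonadj: "(a', a) \<notin> parcs G" "(a', b) \<notin> parcs G"
  shows "(a, b) \<notin> parcs G"
proof
  assume ab: "(a, b) \<in> parcs G"
  obtain z where z: "z \<in> verts Z" "(z, a') \<in> parcs G"
    using adjZ(1) by (auto simp: adjacent_to_component_def parcs_commute)
  have za: "(z, a) \<notin> parcs G" "(z, b) \<notin> parcs G"
    using adjZ z by (auto simp: adjacent_to_component_def parcs_commute)
  have "Z \<noteq> Y" using adjY adjZ by auto
  then have zY: "\<not> adjacent_to_component (with_proj G) z Y"
    using nonadjacent_in_distinct_components[OF Z Y] z by (auto simp: adjacent_to_component_def)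
  have "subgraph Y (with_proj G)"
    using connected_component_subgraph(1)[OF Y] subgraph_induce_subgraphI[OF Q] subgraph_trans
    by blast
  then obtain y where y: "y \<in> verts Y" "(a, y) \<in> parcs G" "(a', y) \<in> parcs G"
    using common_neighbour_in_connected_subgraph[OF free _ connected_component_subgraph(2)[OF Y]]
      adjY adjZ nonadj z za zY by blast
  moreover have "(z, y) \<notin> parcs G" "(y, b) \<notin> parcs G"
    using y zY adjY by (auto simp: adjacent_to_component_def parcs_commute)
  ultimately show False
    using induced_P5_imp_not_free[of z a' y a b] free z za ab nonadj
    by (simp add: parcs_commute)
qed

end

section \<open>Inclusions between sets of adjacent components\<close>

theorem theorem2:
  fixes H :: "'a pair_pre_digraph" and P Q :: "'a set" and v :: 'a
  assumes "pair_bidirected_digraph H"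
    and "connected (with_proj H)"
    and "induced_free (with_proj H) (with_proj (path_graph 5))"
    and "pverts H = P \<union> Q \<union> {v}"
    and "P \<inter> Q = {}" and "v \<notin> P" and "v \<notin> Q"
    and "\<forall>q \<in> Q. v \<rightarrow>\<^bsub>with_proj H\<^esub> q"
    and "\<forall>p \<in> P. \<not> v \<rightarrow>\<^bsub>with_proj H\<^esub> p"
  shows "\<exists>\<^sub>\<le>\<^sub>1 C. C \<in> connected_components (with_proj H \<restriction> P) \<and>
    (\<exists>a \<in> verts C. \<exists>b \<in> verts C.
      \<exists>Y1 \<in> connected_components (with_proj H \<restriction> Q).
      \<exists>Y2 \<in> connected_components (with_proj H \<restriction> Q).
        Y1 \<noteq> Y2 \<and>
        adjacent_to_component (with_proj H) a Y1 \<and> \<not> adjacent_to_component (with_proj H) a Y2 \<and>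
        adjacent_to_component (with_proj H) b Y2 \<and> \<not> adjacent_to_component (with_proj H) b Y1)"
proof -
  interpret pair_bidirected_digraph H by fact
  let ?CP = "connected_components (with_proj H \<restriction> P)"
  let ?CQ = "connected_components (with_proj H \<restriction> Q)"
  let ?adj = "adjacent_to_component (with_proj H)"
  define A where "A x = {Y \<in> ?CQ. ?adj x Y}" for x
  have vQ: "\<forall>q \<in> Q. (v, q) \<in> parcs H" and vP: "\<forall>p \<in> P. (v, p) \<notin> parcs H"
    using assms(8,9) by auto
  have edge: "(x, y) \<in> parcs H" if "x \<in> P" "y \<in> P" "\<not> A x \<subseteq> A y" "\<not> A y \<subseteq> A x" for x y
    using adjacent_if_incomparable[OF assms(3) vQ] vP that unfolding A_def by blast
  \<comment> \<open>The second condition yields a \<open>Y\<close> seen by \<open>x\<close> but not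
    \<open>y\<close>, the first lets \<open>x'\<close> see it too, and the third yields the
    \<open>Z\<close> seen by \<open>x'\<close> alone.\<close>
  have no_edge: "(x, y) \<notin> parcs H"
    if "A x \<subseteq> A x'" "\<not> A x \<subseteq> A y" "\<not> A x' \<subseteq> A x \<union> A y" "(x', x) \<notin> parcs H" "(x', y) \<notin> parcs H"
    for x y x'
    using no_edge_below_private_component[OF assms(3)] assms(4) that unfolding A_def by blast
  have in_P: "x \<in> P" if "C \<in> ?CP" "x \<in> verts C" for x C
    using that verts_connected_component_induce by blast
  have unique: "C = C'"
    if C: "C \<in> ?CP" "a \<in> verts C" "b \<in> verts C" "\<not> A a \<subseteq> A b" "\<not> A b \<subseteq> A a"
      and C': "C' \<in> ?CP" "a' \<in> verts C'" "b' \<in> verts C'" "\<not> A a' \<subseteq> A b'" "\<not> A b' \<subseteq> A a'"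
    for C C' a b a' b'
  proof (rule ccontr)
    assume "C \<noteq> C'"
    then have nonadj: "(x, y) \<notin> parcs H" "(y, x) \<notin> parcs H" if "x \<in> {a, b}" "y \<in> {a', b'}" for x y
      using nonadjacent_in_distinct_components C C' that by blast+
    have ab: "(a, b) \<in> parcs H" and ab': "(a', b') \<in> parcs H"
      using edge in_P C C' by blast+
    have "A x \<subseteq> A y \<or> A y \<subseteq> A x" if "x \<in> {a, b}" "y \<in> {a', b'}" for x y
      using edge in_P C C' nonadj that by blast
    then have "A a \<subseteq> A a' \<or> A a' \<subseteq> A a" "A a \<subseteq> A b' \<or> A b' \<subseteq> A a"
      "A b \<subseteq> A a' \<or> A a' \<subseteq> A b" "A b \<subseteq> A b' \<or> A b' \<subseteq> A b"
      by blast+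
    \<comment> \<open>The four inclusions must all point the same way: two opposite ones sharing a
      vertex would chain to an inclusion within one of the two pairs, and both pairs are
      incomparable.\<close>
    with C(4,5) C'(4,5) consider "A a \<union> A b \<subseteq> A a' \<inter> A b'" | "A a' \<union> A b' \<subseteq> A a \<inter> A b"
      by (smt (verit) Int_subset_iff Un_subset_iff subset_trans)
    then show False
    proof cases
      case 1
      \<comment> \<open>Here \<open>A a'\<close> is not contained in
        \<open>A a \<union> A b\<close>, because that union lies in \<open>A b'\<close> and
        \<open>A a'\<close> does not.\<close>
      then show False using no_edge[of a a' b] ab nonadj C C' by blast
    next
      case 2
      then show False using no_edge[of a' a b'] ab' nonadj C C' by blast
    qed
  qed
  have incomparable: "\<not> A a \<subseteq> A b"
    if "Y \<in> ?CQ" "?adj a Y" "\<not> ?adj b Y" for a b Y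
    using that unfolding A_def by blast
  show ?thesis
  proof (rule Uniq_I, elim conjE bexE)
    fix C C' a b Y1 Y2 a' b' Y1' Y2'
    assume "C \<in> ?CP" "a \<in> verts C" "b \<in> verts C" "Y1 \<in> ?CQ" "Y2 \<in> ?CQ"
      and "?adj a Y1" "\<not> ?adj a Y2" "?adj b Y2" "\<not> ?adj b Y1"
      and "C' \<in> ?CP" "a' \<in> verts C'" "b' \<in> verts C'" "Y1' \<in> ?CQ" "Y2' \<in> ?CQ"
      and "?adj a' Y1'" "\<not> ?adj a' Y2'" "?adj b' Y2'" "\<not> ?adj b' Y1'"
    then show "C = C'"
      by (intro unique incomparable)
  qed
qed

end
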